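(* Let $A$ be a finite alphabet, $m>1$ an integer and $s\colon A\to A^{m\times m}$ a substitution rule. Then there exist a tile set $\tau$ and a map $e\colon\tau\to A$ such that (a) for every $\tau$-tiling $U$ of the plane, the configuration $e\circ U$ is compatible with $s$; and (b) every $A$-configuration compatible with $s$ is of the form $e\circ U$ for some $\tau$-tiling $U$ of the plane.
   Context: A tile set is a finite subset $\tau\subset C^4$ for a finite color set $C$ (left, right, top, bottom colors); a $\tau$-tiling of the plane is a map $U\colon\mathbb{Z}^2\to\tau$ in which adjacent tiles have equal colors on their common side. An $A$-configuration is a map $X\colon\mathbb{Z}^2\to A$ (configurations are considered up to translation). For a substitution rule $s\colon A\to A^{m\times m}$, $s(X)$ is the configuration obtained by replacing each letter $X(i,j)$ by the $m\times m$ block $s(X(i,j))$, placed at the block of cells $\{(mi+a,mj+b):0\le a,b<m\}$. A configuration $X$ is compatible with $s$ if there is an infinite sequence of configurations $X_1,X_2,\ldots$ with $X=s(X_1)$ and $X_i=s(X_{i+1})$ for all $i\ge1$ (equalities up to translation). *)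

theory Defs
  imports Main
begin

text \<open>Tiles are quadruples (left, right, top, bottom) of colours; colours are
natural numbers (any finite colour set can be encoded in nat).
The plane is int \<times> int; the first coordinate increases to the right,
the second increases upwards.\<close>

type_synonym tile = "nat \<times> nat \<times> nat \<times> nat"

definition tile_left :: "tile \<Rightarrow> nat" where "tile_left t = fst t"
definition tile_right :: "tile \<Rightarrow> nat" where "tile_right t = fst (snd t)"
definition tile_top :: "tile \<Rightarrow> nat" where "tile_top t = fst (snd (snd t))"
definition tile_bottom :: "tile \<Rightarrow> nat" where "tile_bottom t = snd (snd (snd t))"

definition is_tiling :: "tile set \<Rightarrow> (int \<times> int \<Rightarrow> tile) \<Rightarrow> bool" where
  "is_tiling \<tau> U \<longleftrightarrow>
     (\<forall>i j. U (i, j) \<in> \<tau>) \<and>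
     (\<forall>i j. tile_right (U (i, j)) = tile_left (U (i + 1, j))) \<and>
     (\<forall>i j. tile_top (U (i, j)) = tile_bottom (U (i, j + 1)))"

definition trans_eq :: "(int \<times> int \<Rightarrow> 'a) \<Rightarrow> (int \<times> int \<Rightarrow> 'a) \<Rightarrow> bool" where
  "trans_eq X Y \<longleftrightarrow> (\<exists>a b. \<forall>i j. X (i + a, j + b) = Y (i, j))"

text \<open>Substitution rule s : A \<rightarrow> A^{m\<times>m}, the block s x given as s x a b for 0 \<le> a,b < m.
The letter X(i,j) is replaced by the block placed at cells (m i + a, m j + b).\<close>
definition subst_conf :: "nat \<Rightarrow> ('a \<Rightarrow> nat \<Rightarrow> nat \<Rightarrow> 'a) \<Rightarrow> (int \<times> int \<Rightarrow> 'a) \<Rightarrow> (int \<times> int \<Rightarrow> 'a)" where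
  "subst_conf m s X = (\<lambda>(x, y). s (X (x div int m, y div int m)) (nat (x mod int m)) (nat (y mod int m)))"

definition compatible :: "nat \<Rightarrow> ('a \<Rightarrow> nat \<Rightarrow> nat \<Rightarrow> 'a) \<Rightarrow> (int \<times> int \<Rightarrow> 'a) \<Rightarrow> bool" where
  "compatible m s X \<longleftrightarrow>
     (\<exists>Xs :: nat \<Rightarrow> (int \<times> int \<Rightarrow> 'a).
        trans_eq X (subst_conf m s (Xs 1)) \<and>
        (\<forall>i \<ge> 1. trans_eq (Xs i) (subst_conf m s (Xs (Suc i)))))"

end

theory Submission
  imports Defs "HOL-Library.Diagonal_Subsequence" "HOL-Library.Countable_Set" "HOL-Real_Asymp.Real_Asymp"
begin

text \<open>The tile set is made self-similar: every tiling splits uniquely into n x n blocks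
which, read as single tiles, tile the plane with the same tile set. A tile knows its position in
its block, the info (position, letter, role) of the block itself, and carries one wire on each
side. Inside a block, row 0 and column 0 bring the four wires of the block to its corner cell,
which inherits the role of the block. Row 1 and column 1 carry the structural data of the block,
generated at cell (1, 1), to the neighbouring blocks, where it is compared with theirs.

What remains is to certify that the data on the wire of row 1 agrees with the info that the cells
of the block believe in. A cell doing this has to know what to expect, and this expectation is
part of its role, hence of its own info; the circularity is broken by giving each
checking cell only one bit of the info. With N checking cells there are 2 N + 2 roles,
while the infos must be encoded in N bits, which is possible once n is large. Passing to a
power of the substitution makes n as large as needed.

Conversely, given a hierarchy of configurations, roles and wires at level k are functions of
those at level k + 1, and compactness provides a solution of this infinite system in which
everything that is never determined at a finite level takes a default value.\<close>

section \<open>Compatible configurations\<close>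

lemma trans_eq_refl: "trans_eq X X"
  unfolding trans_eq_def by (metis add.right_neutral)

lemma trans_eq_trans:
  assumes "trans_eq X Y" "trans_eq Y Z"
  shows "trans_eq X Z"
proof -
  obtain a b where 1: "X (i + a, j + b) = Y (i, j)" for i j
    using assms(1) unfolding trans_eq_def by blast
  obtain c d where 2: "Y (i + c, j + d) = Z (i, j)" for i j
    using assms(2) unfolding trans_eq_def by blast
  have "X (i + (c + a), j + (d + b)) = Z (i, j)" for i j
    using 1[of "i + c" "j + d"] 2[of i j] by (simp add: add.assoc)
  then show ?thesis unfolding trans_eq_def by blast
qed

lemma trans_eq_subst_conf:
  assumes "n > 0" "trans_eq X Y"
  shows "trans_eq (subst_conf n S X) (subst_conf n S Y)"
proof -
  obtain a b where 1: "X (i + a, j + b) = Y (i, j)" for i j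
    using assms(2) unfolding trans_eq_def by blast
  have "subst_conf n S X (i + int n * a, j + int n * b) = subst_conf n S Y (i, j)" for i j
    using assms(1) by (simp add: subst_conf_def 1[symmetric] add.commute)
  then show ?thesis unfolding trans_eq_def by blast
qed

text \<open>Dependent choice assembles the whole hierarchy, so compatibility can be proved by
  exhibiting a single desubstitution step that preserves an invariant.\<close>

lemma compatible_coinduct:
  assumes "P X" and step: "\<And>X. P X \<Longrightarrow> \<exists>Y. P Y \<and> trans_eq X (subst_conf m s Y)"
  shows "compatible m s X"
proof -
  have "\<exists>f. \<forall>k. (P (f k) \<and> (k = 0 \<longrightarrow> f k = X)) \<and> trans_eq (f k) (subst_conf m s (f (Suc k)))"
    by (rule dependent_nat_choice) (use assms in \<open>auto\<close>)
  then obtain f where f: "f 0 = X" "\<And>k. trans_eq (f k) (subst_conf m s (f (Suc k)))"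
    by blast
  then have "trans_eq X (subst_conf m s (f 1))"
    using f(2)[of 0] by simp
  with f(2) show ?thesis
    unfolding compatible_def by blast
qed

lemma compatible_sequence:
  assumes "compatible m s X"
  obtains Xs where "Xs 0 = X" "\<And>k. trans_eq (Xs k) (subst_conf m s (Xs (Suc k)))"
proof -
  obtain Ys where Y: "trans_eq X (subst_conf m s (Ys 1))"
    "\<And>i. i \<ge> 1 \<Longrightarrow> trans_eq (Ys i) (subst_conf m s (Ys (Suc i)))"
    using assms unfolding compatible_def by blast
  show ?thesis
    by (rule that[of "Ys(0 := X)"]) (use Y in \<open>auto simp: Suc_le_eq\<close>)
qed

section \<open>Powers of a substitution rule\<close>

fun subst_pow :: "nat \<Rightarrow> ('a \<Rightarrow> nat \<Rightarrow> nat \<Rightarrow> 'a) \<Rightarrow> nat \<Rightarrow> 'a \<Rightarrow> nat \<Rightarrow> nat \<Rightarrow> 'a" where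
  "subst_pow m s 0 x a b = x"
| "subst_pow m s (Suc k) x a b = s (subst_pow m s k x (a div m) (b div m)) (a mod m) (b mod m)"

declare subst_pow.simps(2) [simp del]

lemma subst_conf_pow_0 [simp]: "subst_conf (m ^ 0) (subst_pow m s 0) X = X"
  by (auto simp: subst_conf_def fun_eq_iff)

text \<open>In base \<open>m\<close>, the lowest digit of a coordinate is its place in the block of
  the last application of \<open>s\<close>; the higher digits locate that block in the
  \<open>k\<close>-fold image.\<close>

lemma subst_conf_pow_Suc:
  assumes "m > 0"
  shows "subst_conf (m ^ Suc k) (subst_pow m s (Suc k)) X
    = subst_conf m s (subst_conf (m ^ k) (subst_pow m s k) X)"
proof -
  have 1: "x div int (m ^ Suc k) = x div int m div int (m ^ k)" for x
    using assms by (simp add: zdiv_zmult2_eq)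
  have 0: "x mod int (m ^ Suc k) = int m * (x div int m mod int (m ^ k)) + x mod int m" for x
    using assms by (simp add: zmod_zmult2_eq)
  have nn: "0 \<le> x mod int m" "x mod int m < int m" "0 \<le> x div int m mod int (m ^ k)" for x
    using assms by auto
  have n: "nat (x mod int (m ^ Suc k)) = m * nat (x div int m mod int (m ^ k)) + nat (x mod int m)" for x
    unfolding 0 using nn[of x] by (simp add: nat_add_distrib nat_mult_distrib)
  have l: "nat (x mod int m) < m" for x
    using nn[of x] by linarith
  have 2: "nat (x mod int (m ^ Suc k)) div m = nat (x div int m mod int (m ^ k))" for x
    unfolding n using l[of x] assms by simp
  have 3: "nat (x mod int (m ^ Suc k)) mod m = nat (x mod int m)" for x
    unfolding n using l[of x] assms by simp
  show ?thesis
    unfolding subst_conf_def fun_eq_iff by (simp only: 1 2 3 subst_pow.simps split: prod.splits) simp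
qed

text \<open>From \<open>s\<close> to its power, keep every \<open>K\<close>-th level of the
  hierarchy. Conversely, insert the partial images between consecutive levels and peel off one
  application of \<open>s\<close> at a time.\<close>

lemma compatible_subst_pow_iff:
  assumes "m > 0" "K > 0"
  shows "compatible (m ^ K) (subst_pow m s K) X \<longleftrightarrow> compatible m s X"
proof
  assume X: "compatible m s X"
  then obtain Xs where Xs: "Xs 0 = X" "\<And>k. trans_eq (Xs k) (subst_conf m s (Xs (Suc k)))"
    by (rule compatible_sequence) blast
  have pow: "trans_eq (Xs i) (subst_conf (m ^ j) (subst_pow m s j) (Xs (i + j)))" for i j
  proof (induction j arbitrary: i)
    case 0
    then show ?case by (metis add.right_neutral subst_conf_pow_0 trans_eq_refl)
  next
    case (Suc j)
    have "trans_eq (subst_conf m s (Xs (Suc i)))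
        (subst_conf m s (subst_conf (m ^ j) (subst_pow m s j) (Xs (Suc i + j))))"
      by (rule trans_eq_subst_conf[OF assms(1) Suc])
    then show ?case
      using trans_eq_trans[OF Xs(2)[of i]] unfolding subst_conf_pow_Suc[OF assms(1)] by simp
  qed
  let ?P = "\<lambda>Y. \<exists>i. Y = Xs i"
  show "compatible (m ^ K) (subst_pow m s K) X"
    by (rule compatible_coinduct[where P = ?P]) (use Xs(1) pow in blast)+
next
  let ?C = "compatible (m ^ K) (subst_pow m s K)"
  let ?P = "\<lambda>Z. \<exists>j Y. ?C Y \<and> trans_eq Z (subst_conf (m ^ j) (subst_pow m s j) Y)"
  obtain K' where K': "K = Suc K'" using assms(2) by (cases K) auto
  have unfold: "\<exists>Y'. ?C Y' \<and> trans_eq Y (subst_conf (m ^ K) (subst_pow m s K) Y')" if Y: "?C Y" for Y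
  proof -
    obtain Xs where Xs: "Xs 0 = Y"
      "\<And>k. trans_eq (Xs k) (subst_conf (m ^ K) (subst_pow m s K) (Xs (Suc k)))"
      using compatible_sequence[OF Y] by blast
    have "?C (Xs 1)"
      by (rule compatible_coinduct[where P = "\<lambda>Y. \<exists>i. Y = Xs i"]) (use Xs in blast)+
    then show ?thesis using Xs by (metis One_nat_def)
  qed
  assume X: "?C X"
  show "compatible m s X"
  proof (rule compatible_coinduct[where P = ?P])
    show "?P X" using X by (metis subst_conf_pow_0 trans_eq_refl)
    fix Z assume "?P Z"
    then obtain j Y where Y: "?C Y" "trans_eq Z (subst_conf (m ^ j) (subst_pow m s j) Y)" by blast
    \<comment> \<open>When no application of \<open>s\<close> remains, the next level of the
      \<open>K\<close>-fold hierarchy supplies \<open>K\<close> new ones.\<close>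
    have "\<exists>j Y. ?C Y \<and> trans_eq Z (subst_conf (m ^ Suc j) (subst_pow m s (Suc j)) Y)"
    proof (cases j)
      case 0
      then show ?thesis
        using Y unfold[OF Y(1)] trans_eq_trans unfolding K' by (metis subst_conf_pow_0)
    next
      case (Suc j')
      then show ?thesis using Y by blast
    qed
    then show "\<exists>Y. ?P Y \<and> trans_eq Z (subst_conf m s Y)"
      unfolding subst_conf_pow_Suc[OF assms(1)] using trans_eq_refl by blast
  qed
qed

section \<open>Solving infinite systems of equations by compactness\<close>

text \<open>Start from the default at ever higher levels, compute downwards, and pass to a diagonal
  subsequence. The last conclusion covers ancestor chains along which the default is always a fixed
  point: every approximation, hence the limit, is the default there.\<close>

lemma ex_solution_tower:
  fixes F :: "nat \<Rightarrow> 'p::countable \<Rightarrow> 'v \<Rightarrow> 'v" and par :: "nat \<Rightarrow> 'p \<Rightarrow> 'p"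
  assumes V: "finite V" "d \<in> V" "\<And>k p y. y \<in> V \<Longrightarrow> F k p y \<in> V"
  obtains v where "\<And>k p. v k p = F k p (v (Suc k) (par k p))"
    "\<And>k p. v k p \<in> V" "\<And>Z k p. (\<And>k p. Z k p \<Longrightarrow> F k p d = d \<and> Z (Suc k) (par k p)) \<Longrightarrow> Z k p \<Longrightarrow> v k p = d"
proof -
  define w where "w = rec_nat (\<lambda>k p. d) (\<lambda>t f k p. F k p (f (Suc k) (par k p)))"
  have w0: "w 0 k p = d" and wS: "w (Suc t) k p = F k p (w t (Suc k) (par k p))" for t k p
    by (simp_all add: w_def)
  have wV: "w t k p \<in> V" for t k p
    by (induction t arbitrary: k p) (simp_all add: w0 wS V)
  have wZ: "w t k p = d"
    if Z: "\<And>k p. Z k p \<Longrightarrow> F k p d = d \<and> Z (Suc k) (par k p)" "Z k p" for Z t k p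
    using Z(2) by (induction t arbitrary: k p) (simp_all add: w0 wS Z(1))
  \<comment> \<open>The \<open>n\<close>-th approximation is \<open>d\<close> at all levels from
    \<open>n\<close> on and satisfies the equations at all levels below \<open>n\<close>.\<close>
  define u where "u = (\<lambda>n k p. w (n - k) k p)"
  have u: "u n k p = F k p (u n (Suc k) (par k p))" if "k < n" for n k p
    using that wS[of "n - Suc k" k p] by (simp add: u_def Suc_diff_Suc)
  \<comment> \<open>Here \<open>q\<close> codes a pair \<open>(k, p)\<close>, and
    \<open>P q r\<close> says that the value there is constant along \<open>r\<close>. Pigeonhole on
    the finite set \<open>V\<close> gives such a refinement of any sequence.\<close>
  define P where "P = (\<lambda>q (r :: nat \<Rightarrow> nat). \<exists>c. \<forall>i. (case from_nat q of (k, p :: 'p) \<Rightarrow> u (r i) k p) = c)"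
  interpret subseqs P
  proof
    fix q and r :: "nat \<Rightarrow> nat"
    obtain k p where kp: "from_nat q = (k :: nat, p :: 'p)" by fastforce
    have "finite (range (\<lambda>i. u (r i) k p))"
      by (rule finite_subset[OF _ V(1)]) (auto simp: u_def wV)
    then obtain i0 where inf: "infinite {i. u (r i) k p = u (r i0) k p}"
      using pigeonhole_infinite[of "UNIV :: nat set" "\<lambda>i. u (r i) k p"] by auto
    then have "strict_mono (enumerate {i. u (r i) k p = u (r i0) k p})"
      by (rule strict_mono_enumerate)
    moreover have "u (r (enumerate {i. u (r i) k p = u (r i0) k p} i)) k p = u (r i0) k p" for i
      using enumerate_in_set[OF inf, of i] by simp
    ultimately show "\<exists>r'. strict_mono r' \<and> P q (r \<circ> r')"
      unfolding P_def kp by auto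
  qed
  have ev: "\<exists>c. \<forall>\<^sub>F i in sequentially. u (diagseq i) k p = c" for k p
  proof -
    define q where "q = to_nat (k, p)"
    have "P q (diagseq \<circ> (+) (Suc q))"
      by (rule diagseq_holds) (auto simp: P_def)
    then obtain c where c: "\<And>i. u (diagseq (Suc q + i)) k p = c"
      by (auto simp: P_def q_def)
    have "u (diagseq i) k p = c" if "i \<ge> Suc q" for i
      using c[of "i - Suc q"] that by simp
    then show ?thesis by (auto simp: eventually_sequentially)
  qed
  then obtain v where v: "\<And>k p. \<forall>\<^sub>F i in sequentially. u (diagseq i) k p = v k p"
    by metis
  have large: "\<forall>\<^sub>F i in sequentially. k < diagseq i" for k
    unfolding eventually_sequentially
    using seq_suble[OF subseq_diagseq] by (meson Suc_le_eq order.trans)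
  show ?thesis
  proof (rule that)
    fix k p
    have "\<forall>\<^sub>F i in sequentially. v k p = F k p (v (Suc k) (par k p))"
      using v[of k p] v[of "Suc k" "par k p"] large[of k]
    proof eventually_elim
      case (elim i)
      then show ?case using u[of k "diagseq i" p] by simp
    qed
    then show "v k p = F k p (v (Suc k) (par k p))" by simp
    have "\<forall>\<^sub>F i in sequentially. v k p \<in> V"
      using v[of k p] by eventually_elim (metis u_def wV)
    then show "v k p \<in> V" by simp
    fix Z assume Z: "\<And>k p. Z k p \<Longrightarrow> F k p d = d \<and> Z (Suc k) (par k p)" "Z k p"
    have "\<forall>\<^sub>F i in sequentially. v k p = d"
      using v[of k p] by eventually_elim (use wZ[of Z, OF Z] in \<open>simp add: u_def\<close>)
    then show "v k p = d" by simp
  qed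
qed


section \<open>Self-similar tiles\<close>

datatype role = Cross | Main | Check nat bool

type_synonym 'a info = "(nat \<times> nat) \<times> 'a \<times> role"
type_synonym 'a addr = "(nat \<times> nat) \<times> 'a info"

text \<open>In row 1, the \<open>N\<close> cells in columns 2 to \<open>n - 1\<close> check one bit
  each, whence \<open>n = N + 2\<close>. Via \<open>\<beta>\<close>, an info is coded by
  \<open>N\<close> bits.\<close>

locale self_similar =
  fixes n N :: nat and S :: "'a::finite \<Rightarrow> nat \<Rightarrow> nat \<Rightarrow> 'a" and \<beta> :: "'a info \<Rightarrow> nat set"
    and roles :: "role set" and infos :: "'a info set"
  defines "roles \<equiv> insert Cross (insert Main (case_prod Check ` ({..<N} \<times> UNIV)))"
    and "infos \<equiv> ({..<n} \<times> {..<n}) \<times> UNIV \<times> roles"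
  assumes n: "n = N + 2" and N: "N > 0"
    and inj: "inj_on \<beta> infos" and bits: "\<And>I. I \<in> infos \<Longrightarrow> \<beta> I \<subseteq> {..<N}"
begin

text \<open>\<open>Check i c\<close> asserts that bit \<open>i\<close> of the info derived from the address on the wire is \<open>c\<close>;
an address is a position together with the info of the enclosing block.\<close>

fun role_of :: "nat \<times> nat \<Rightarrow> 'a info \<Rightarrow> role" where
  "role_of (a, b) J = (if a = 0 \<and> b = 0 then snd (snd J) else if a = 1 \<and> b = 1 then Main
     else if 2 \<le> a \<and> b = 1 then Check (a - 2) (a - 2 \<in> \<beta> J) else Cross)"

fun info_of :: "'a addr \<Rightarrow> 'a info" where
  "info_of ((a, b), J) = ((a, b), S (fst (snd J)) a b, role_of (a, b) J)"

definition letter :: "'a addr \<Rightarrow> 'a" where "letter x = fst (snd (info_of x))"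
definition role :: "'a addr \<Rightarrow> role" where "role x = snd (snd (info_of x))"

definition addrs :: "'a addr set" where "addrs = ({..<n} \<times> {..<n}) \<times> infos"
text \<open>\<open>None\<close> serves as the default in the compactness argument and as the content
  of wires that transport nothing.\<close>

definition wires :: "'a addr option set" where "wires = insert None (Some ` addrs)"

text \<open>Across a block border the two block infos are unconstrained here; the blocks are
  compared one level up, by the \<open>Main\<close> cell.\<close>

definition hcompat :: "'a addr \<Rightarrow> 'a addr \<Rightarrow> bool" where
  "hcompat y x \<longleftrightarrow> fst (fst x) = (fst (fst y) + 1) mod n \<and> snd (fst x) = snd (fst y) \<and>
     (fst (fst x) \<noteq> 0 \<longrightarrow> snd y = snd x)"

definition vcompat :: "'a addr \<Rightarrow> 'a addr \<Rightarrow> bool" where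
  "vcompat y x \<longleftrightarrow> snd (fst x) = (snd (fst y) + 1) mod n \<and> fst (fst x) = fst (fst y) \<and>
     (snd (fst x) \<noteq> 0 \<longrightarrow> snd y = snd x)"

text \<open>A \<open>Main\<close> cell guesses the address \<open>x\<close> of its block and sends
  it right and up; \<open>y\<close> and \<open>z\<close> arrive from the blocks to the left and
  below. \<open>Check\<close> transmits like \<open>Cross\<close> and tests one bit of the
  guess.\<close>

fun local_rule :: "role \<Rightarrow> 'a addr option \<Rightarrow> 'a addr option \<Rightarrow> 'a addr option \<Rightarrow> 'a addr option \<Rightarrow> bool" where
  "local_rule Cross wl wr wt wb \<longleftrightarrow> wl = wr \<and> wt = wb"
| "local_rule (Check i c) wl wr wt wb \<longleftrightarrow> wl = wr \<and> wt = wb \<and> (\<exists>x. wl = Some x \<and> (i \<in> \<beta> (info_of x)) = c)"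
| "local_rule Main wl wr wt wb \<longleftrightarrow> (\<exists>x y z. wr = Some x \<and> wt = Some x \<and> wl = Some y \<and> wb = Some z \<and>
     hcompat y x \<and> vcompat z x)"

text \<open>\<open>h i j\<close> and \<open>v i j\<close> are the wires on the right and on the top side of cell \<open>(i, j)\<close>.\<close>

definition valid :: "(int \<Rightarrow> int \<Rightarrow> 'a addr) \<Rightarrow> (int \<Rightarrow> int \<Rightarrow> 'a addr option) \<Rightarrow> (int \<Rightarrow> int \<Rightarrow> 'a addr option) \<Rightarrow> bool" where
  "valid x h v \<longleftrightarrow> (\<forall>i j. x i j \<in> addrs \<and> h i j \<in> wires \<and> v i j \<in> wires \<and>
     hcompat (x (i - 1) j) (x i j) \<and> vcompat (x i (j - 1)) (x i j) \<and>
     local_rule (role (x i j)) (h (i - 1) j) (h i j) (v i j) (v i (j - 1)))"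

lemma validD:
  assumes "valid x h v"
  shows "x i j \<in> addrs" "h i j \<in> wires" "v i j \<in> wires"
    "hcompat (x (i - 1) j) (x i j)" "vcompat (x i (j - 1)) (x i j)"
    "local_rule (role (x i j)) (h (i - 1) j) (h i j) (v i j) (v i (j - 1))"
  using assms unfolding valid_def by blast+

lemma finite_roles: "finite roles" by (simp add: roles_def)
lemma finite_infos: "finite infos" by (simp add: infos_def finite_roles)
lemma finite_addrs: "finite addrs" by (simp add: addrs_def finite_infos)
lemma finite_wires: "finite wires" by (simp add: wires_def finite_addrs)

lemma n_ge: "n \<ge> 3" using n N by simp

lemma role_of_in_roles:
  assumes "a < n" "snd (snd J) \<in> roles"
  shows "role_of (a, b) J \<in> roles"
proof -
  have "Check (a - 2) c \<in> roles" if "2 \<le> a" for c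
    using that assms(1) n unfolding roles_def by force
  then show ?thesis using assms(2) by (auto simp: roles_def)
qed

lemma info_of_in_infos:
  assumes "x \<in> addrs" shows "info_of x \<in> infos"
proof -
  obtain a b J where x: "x = ((a, b), J)" "a < n" "b < n" "J \<in> infos"
    using assms by (auto simp: addrs_def)
  then have "snd (snd J) \<in> roles" by (auto simp: infos_def)
  then show ?thesis
    using x role_of_in_roles by (simp add: infos_def del: role_of.simps)
qed

text \<open>This is how the separate one-bit checks combine into equality of infos.\<close>

lemma info_eqI:
  assumes "I \<in> infos" "J \<in> infos" "\<And>i. i < N \<Longrightarrow> i \<in> \<beta> I \<longleftrightarrow> i \<in> \<beta> J"
  shows "I = J"
proof -
  have "\<beta> I = \<beta> J" using bits[OF assms(1)] bits[OF assms(2)] assms(3) by blast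
  then show ?thesis using inj assms by (auto dest: inj_onD)
qed

subsection \<open>Grouping a tiling into blocks\<close>

text \<open>One coordinate advances by 1 modulo \<open>n\<close> at each step while the other stays
  fixed, so the position at the origin determines all others, and thereby the grid of
  blocks.\<close>

lemma valid_positions:
  assumes "valid x h v"
  obtains p q where "\<And>i j. fst (x i j) = (nat ((i + p) mod int n), nat ((j + q) mod int n))"
proof -
  have n0: "int n > 0" using n by simp
  define A where "A i j = int (fst (fst (x i j)))" for i j
  define B where "B i j = int (snd (fst (x i j)))" for i j
  have bnd: "0 \<le> A i j" "A i j < int n" "0 \<le> B i j" "B i j < int n" for i j
    using validD(1)[OF assms, of i j] unfolding A_def B_def addrs_def by auto
  \<comment> \<open>Inverts the cyclic successor, for the inductions towards negative
    coordinates.\<close>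
  have step: "(u + 1) mod int n = w \<longleftrightarrow> u = (w - 1) mod int n"
    if "0 \<le> u" "u < int n" "0 \<le> w" "w < int n" for u w
    using that by (metis add_diff_cancel diff_add_cancel mod_add_left_eq mod_diff_left_eq mod_pos_pos_trivial)
  have h: "A i j = (A (i - 1) j + 1) mod int n" "B i j = B (i - 1) j" for i j
    using validD(4)[OF assms, of i j] unfolding hcompat_def A_def B_def
    by (simp_all add: zmod_int add.commute)
  have v: "B i j = (B i (j - 1) + 1) mod int n" "A i j = A i (j - 1)" for i j
    using validD(5)[OF assms, of i j] unfolding vcompat_def A_def B_def
    by (simp_all add: zmod_int add.commute)
  have A0: "A i j = A i 0" for i j
    by (induction j rule: int_induct[where k = 0]) (use v(2) in \<open>auto, metis add_diff_cancel\<close>)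
  have B0: "B i j = B 0 j" for i j
    by (induction i rule: int_induct[where k = 0]) (use h(2) in \<open>auto, metis add_diff_cancel\<close>)
  have A1: "A i 0 = (i + A 0 0) mod int n" for i
  proof (induction i rule: int_induct[where k = 0])
    case base
    then show ?case using bnd by simp
  next
    case (step1 i)
    then show ?case using h(1)[of "i + 1" 0] by (simp add: mod_simps algebra_simps)
  next
    case (step2 i)
    then have "A (i - 1) 0 = (A i 0 - 1) mod int n"
      using h(1)[of i 0] step bnd by metis
    then show ?case using step2 by (simp add: mod_simps algebra_simps)
  qed
  have B1: "B 0 j = (j + B 0 0) mod int n" for j
  proof (induction j rule: int_induct[where k = 0])
    case base
    then show ?case using bnd by simp
  next
    case (step1 i)
    then show ?case using v(1)[of 0 "i + 1"] by (simp add: mod_simps algebra_simps)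
  next
    case (step2 i)
    then have "B 0 (i - 1) = (B 0 i - 1) mod int n"
      using v(1)[of 0 i] step bnd by metis
    then show ?case using step2 by (simp add: mod_simps algebra_simps)
  qed
  have "fst (x i j) = (nat ((i + A 0 0) mod int n), nat ((j + B 0 0) mod int n))" for i j
    using A0[of i j] A1[of i] B0[of i j] B1[of j] unfolding A_def B_def
    by (metis nat_int prod.collapse)
  then show ?thesis by (rule that)
qed

text \<open>All cells of a block share one info \<open>par\<close>. The address sent out by its
  \<open>Main\<close> cell is certified to have this info, and the corner cell then enforces on the
  wires of the block the very rule its role demands.\<close>

lemma desubstitute_aligned:
  assumes V: "valid x h v"
    and pos: "\<And>i j. fst (x i j) = (nat (i mod int n), nat (j mod int n))"
  obtains x' h' v' where "valid x' h' v'"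
    "\<And>i j. letter (x i j) = S (letter (x' (i div int n) (j div int n))) (nat (i mod int n)) (nat (j mod int n))"
proof -
  let ?n = "int n"
  define par where "par I J = snd (x (?n * I) (?n * J))" for I J
  have posb: "fst (x (?n * I + int a) (?n * J + int b)) = (a, b)" if "a < n" "b < n" for I J a b
    using that by (simp add: pos)
  have parb: "snd (x (?n * I + int a) (?n * J + int b)) = par I J" if "a < n" "b < n" for I J a b
  proof -
    have row: "snd (x (?n * I + int a) (?n * J)) = par I J" using \<open>a < n\<close>
    proof (induction a)
      case (Suc a)
      have e: "?n * I + int (Suc a) - 1 = ?n * I + int a" by simp
      have "fst (fst (x (?n * I + int (Suc a)) (?n * J))) \<noteq> 0"
        using posb[of "Suc a" 0 I J] Suc.prems by simp
      then show ?case
        using validD(4)[OF V, of "?n * I + int (Suc a)" "?n * J"] Suc unfolding hcompat_def e by simp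
    qed (simp add: par_def)
    show ?thesis using \<open>b < n\<close>
    proof (induction b)
      case (Suc b)
      have e: "?n * J + int (Suc b) - 1 = ?n * J + int b" by simp
      have "snd (fst (x (?n * I + int a) (?n * J + int (Suc b)))) \<noteq> 0"
        using posb[of a "Suc b" I J] Suc.prems \<open>a < n\<close> by simp
      then show ?case
        using validD(5)[OF V, of "?n * I + int a" "?n * J + int (Suc b)"] Suc unfolding vcompat_def e by simp
    qed (simp add: row)
  qed
  have xb: "x (?n * I + int a) (?n * J + int b) = ((a, b), par I J)" if "a < n" "b < n" for I J a b
    using posb[OF that] parb[OF that] by (metis prod.collapse)
  have rule: "local_rule (role_of (a, b) (par I J)) (h (?n * I + int a - 1) (?n * J + int b))
      (h (?n * I + int a) (?n * J + int b)) (v (?n * I + int a) (?n * J + int b))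
      (v (?n * I + int a) (?n * J + int b - 1))" if "a < n" "b < n" for I J a b
    using validD(6)[OF V, of "?n * I + int a" "?n * J + int b"] unfolding xb[OF that] role_def
    by (simp del: role_of.simps)
  have par_in: "par I J \<in> infos" for I J
    using validD(1)[OF V, of "?n * I" "?n * J"] by (auto simp: par_def addrs_def)
  \<comment> \<open>The address of a block is what its \<open>Main\<close> cell emits; its wires are
    those leaving the corner cell.\<close>
  define x' where "x' I J = the (h (?n * I + 1) (?n * J + 1))" for I J
  define h' where "h' I J = h (?n * I) (?n * J)" for I J
  define v' where "v' I J = v (?n * I) (?n * J)" for I J
  have main: "h (?n * I + 1) (?n * J + 1) = Some (x' I J)" "v (?n * I + 1) (?n * J + 1) = Some (x' I J)"
    "\<exists>y z. h (?n * I) (?n * J + 1) = Some y \<and> v (?n * I + 1) (?n * J) = Some z \<and>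
      hcompat y (x' I J) \<and> vcompat z (x' I J)" for I J
    using rule[of 1 1 I J] n_ge by (auto simp: x'_def)
  have row1: "h (?n * I + int a) (?n * J + 1) = Some (x' I J)" if "1 \<le> a" "a < n" for I J a
    using that
  proof (induction a rule: nat_induct_at_least)
    case base
    then show ?case using main(1) by simp
  next
    case (Suc a)
    then show ?case using rule[of "Suc a" 1 I J] by (simp add: algebra_simps)
  qed
  have col1: "v (?n * I + 1) (?n * J + int b) = Some (x' I J)" if "1 \<le> b" "b < n" for I J b
    using that
  proof (induction b rule: nat_induct_at_least)
    case base
    then show ?case using main(2) by simp
  next
    case (Suc b)
    then show ?case using rule[of 1 "Suc b" I J] by (simp add: algebra_simps)
  qed
  have row0: "h (?n * I + int a) (?n * J) = h' I J" if "a < n" for I J a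
    using that
  proof (induction a)
    case (Suc a)
    then show ?case using rule[of "Suc a" 0 I J] n_ge by (simp add: algebra_simps)
  qed (simp add: h'_def)
  have col0: "v (?n * I) (?n * J + int b) = v' I J" if "b < n" for I J b
    using that
  proof (induction b)
    case (Suc b)
    then show ?case using rule[of 0 "Suc b" I J] n_ge by (simp add: algebra_simps)
  qed (simp add: v'_def)
  \<comment> \<open>The left neighbour of column 0 is the last column of the preceding block, so
    wires are handed over from there.\<close>
  have last: "?n * I - 1 = ?n * (I - 1) + int (n - 1)" for I
    using n_ge by (simp add: algebra_simps of_nat_diff)
  have left: "h (?n * I) (?n * J + 1) = Some (x' (I - 1) J)" for I J
    using rule[of 0 1 I J] row1[of "n - 1" "I - 1" J] n_ge by (simp add: last)
  have bottom: "v (?n * I + 1) (?n * J) = Some (x' I (J - 1))" for I J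
    using rule[of 1 0 I J] col1[of "n - 1" I "J - 1"] n_ge by (simp add: last)
  have x'_in: "x' I J \<in> addrs" for I J
    using validD(2)[OF V, of "?n * I + 1" "?n * J + 1"] main(1)[of I J] by (auto simp: wires_def)
  \<comment> \<open>Cell \<open>(i + 2, 1)\<close> has role \<open>Check i\<close>, with the
    expected bit taken from \<open>par\<close>, and row 1 brings it the emitted address.\<close>
  have info: "info_of (x' I J) = par I J" for I J
  proof (rule info_eqI[OF info_of_in_infos[OF x'_in] par_in])
    fix i assume "i < N"
    then have "i + 2 < n" using n by simp
    then show "i \<in> \<beta> (info_of (x' I J)) \<longleftrightarrow> i \<in> \<beta> (par I J)"
      using rule[of "i + 2" 1 I J] row1[of "i + 2" I J] by (auto simp: algebra_simps simp del: split_paired_Ex info_of.simps)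
  qed
  have "valid x' h' v'"
    unfolding valid_def
  proof (intro allI conjI)
    fix I J
    show "x' I J \<in> addrs" by (rule x'_in)
    show "h' I J \<in> wires" "v' I J \<in> wires"
      unfolding h'_def v'_def using validD(2,3)[OF V] by auto
    show "hcompat (x' (I - 1) J) (x' I J)" "vcompat (x' I (J - 1)) (x' I J)"
      using main(3)[of I J] left[of I J] bottom[of I J] by auto
    have "h (?n * I - 1) (?n * J) = h' (I - 1) J" "v (?n * I) (?n * J - 1) = v' I (J - 1)"
      using row0[of "n - 1" "I - 1" J] col0[of "n - 1" I "J - 1"] n_ge by (simp_all add: last)
    \<comment> \<open>The corner cell has the role stored in \<open>par\<close>, which is the role
      of \<open>x'\<close> by \<open>info\<close>.\<close>
    then show "local_rule (role (x' I J)) (h' (I - 1) J) (h' I J) (v' I J) (v' I (J - 1))"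
      using rule[of 0 0 I J] n_ge by (simp add: role_def info h'_def v'_def)
  qed
  moreover have "letter (x i j) = S (letter (x' (i div ?n) (j div ?n))) (nat (i mod ?n)) (nat (j mod ?n))" for i j
  proof -
    have "nat (i mod ?n) < n" "nat (j mod ?n) < n" using n_ge by (simp_all add: nat_less_iff)
    from xb[OF this, of "i div ?n" "j div ?n"] show ?thesis
      using n_ge by (simp add: letter_def info)
  qed
  ultimately show ?thesis by (rule that)
qed

lemma desubstitute:
  assumes "valid x h v"
  shows "\<exists>x' h' v'. valid x' h' v' \<and>
    trans_eq (\<lambda>(i, j). letter (x i j)) (subst_conf n S (\<lambda>(i, j). letter (x' i j)))"
proof -
  obtain p q where pq: "\<And>i j. fst (x i j) = (nat ((i + p) mod int n), nat ((j + q) mod int n))"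
    using valid_positions[OF assms] by blast
  let ?x = "\<lambda>i j. x (i - p) (j - q)"
  have "valid ?x (\<lambda>i j. h (i - p) (j - q)) (\<lambda>i j. v (i - p) (j - q))"
    using assms unfolding valid_def by (metis diff_right_commute)
  from desubstitute_aligned[OF this] obtain x' h' v' where v': "valid x' h' v'"
    "\<And>i j. letter (?x i j) = S (letter (x' (i div int n) (j div int n))) (nat (i mod int n)) (nat (j mod int n))"
    using pq by auto
  have "trans_eq (\<lambda>(i, j). letter (x i j)) (subst_conf n S (\<lambda>(i, j). letter (x' i j)))"
    unfolding trans_eq_def subst_conf_def using v'(2)
    by (intro exI[of _ "- p"] exI[of _ "- q"]) simp
  with v'(1) show ?thesis by blast
qed

lemma valid_imp_compatible:
  assumes "valid x h v"
  shows "compatible n S (\<lambda>(i, j). letter (x i j))"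
proof (rule compatible_coinduct[where P = "\<lambda>X. \<exists>x h v. valid x h v \<and> X = (\<lambda>(i, j). letter (x i j))"])
qed (use assms desubstitute in blast)+

subsection \<open>Refining a hierarchy into a tiling\<close>

text \<open>A step to the left or down either stays in the block or enters the last column or row of
  the previous one; \<open>c\<close> is the offset of the block grid.\<close>

lemma div_mod_pred:
  fixes i c :: int
  defines "q \<equiv> \<lambda>i. (i - c) div int n" and "r \<equiv> \<lambda>i. nat ((i - c) mod int n)"
  shows "r i = 0 \<Longrightarrow> q (i - 1) = q i - 1" "r i = 0 \<Longrightarrow> r (i - 1) = n - 1"
    "r i \<noteq> 0 \<Longrightarrow> q (i - 1) = q i" "r i \<noteq> 0 \<Longrightarrow> r (i - 1) = r i - 1" "r i < n"
proof -
  have n0: "int n > 0" using n by simp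
  define d where "d = (i - c) div int n"
  define e where "e = (i - c) mod int n"
  have i: "i - c = d * int n + e" "i - 1 - c = d * int n + (e - 1)" "0 \<le> e" "e < int n"
    using n0 unfolding d_def e_def by (simp_all add: algebra_simps)
  have "(i - 1 - c) div int n = d - 1 \<and> (i - 1 - c) mod int n = int n - 1" if "e = 0"
  proof -
    have "i - 1 - c = int n * (d - 1) + (int n - 1)" using i that by (simp add: algebra_simps)
    from int_div_pos_eq[OF this] int_mod_pos_eq[OF this] show ?thesis using n0 by simp
  qed
  then show "r i = 0 \<Longrightarrow> q (i - 1) = q i - 1" "r i = 0 \<Longrightarrow> r (i - 1) = n - 1"
    using i(3,4) n0 unfolding q_def r_def d_def[symmetric] e_def[symmetric] by (simp_all add: nat_diff_distrib)
  have "(i - 1 - c) div int n = d \<and> (i - 1 - c) mod int n = e - 1" if "e \<noteq> 0"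
  proof -
    have "i - 1 - c = int n * d + (e - 1)" using i by (simp add: algebra_simps)
    from int_div_pos_eq[OF this] int_mod_pos_eq[OF this] show ?thesis using i(3,4) that by simp
  qed
  then show "r i \<noteq> 0 \<Longrightarrow> q (i - 1) = q i" "r i \<noteq> 0 \<Longrightarrow> r (i - 1) = r i - 1"
    using i(3,4) n0 unfolding q_def r_def d_def[symmetric] e_def[symmetric] by (simp_all add: nat_diff_distrib)
  show "r i < n" using i unfolding r_def e_def[symmetric] by simp
qed

text \<open>All levels of the hierarchy are decorated simultaneously. Roles are solved first, since
  infos and addresses contain them; the wires, which carry addresses, come afterwards.\<close>

lemma compatible_imp_valid:
  assumes "compatible n S X"
  obtains x h v where "valid x h v" "\<And>i j. letter (x i j) = X (i, j)"
proof -
  obtain Xs where Xs: "Xs 0 = X" "\<And>k. trans_eq (Xs k) (subst_conf n S (Xs (Suc k)))"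
    using compatible_sequence[OF assms] by blast
  then have "\<forall>k. \<exists>a b. \<forall>i j. Xs k (i + a, j + b) = subst_conf n S (Xs (Suc k)) (i, j)"
    unfolding trans_eq_def by blast
  \<comment> \<open>Each level has its own translation, giving the grid offsets in the parent
    coordinates \<open>px\<close>, \<open>py\<close> and the positions \<open>rx\<close>,
    \<open>ry\<close>.\<close>
  then obtain A B where AB: "\<And>k i j. Xs k (i + A k, j + B k) = subst_conf n S (Xs (Suc k)) (i, j)"
    by metis
  define px where "px k i = (i - A k) div int n" for k i
  define rx where "rx k i = nat ((i - A k) mod int n)" for k i
  define py where "py k j = (j - B k) div int n" for k j
  define ry where "ry k j = nat ((j - B k) mod int n)" for k j
  note px = div_mod_pred[where c = "A k" for k, folded px_def rx_def]
  note py = div_mod_pred[where c = "B k" for k, folded py_def ry_def]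
  have L: "Xs k (i, j) = S (Xs (Suc k) (px k i, py k j)) (rx k i) (ry k j)" for k i j
    using AB[of k "i - A k" "j - B k"] by (simp add: subst_conf_def px_def py_def rx_def ry_def)
  define par where "par k = (\<lambda>(i, j). (px k i, py k j))" for k
  define pos where "pos k = (\<lambda>(i, j). (rx k i, ry k j))" for k
  \<comment> \<open>The unknown \<open>r\<close> is the role of the parent block; its position and
    letter are known.\<close>
  define FR where "FR k p r = role_of (pos k p) (pos (Suc k) (par k p), Xs (Suc k) (par k p), r)" for k p r
  obtain ro where ro: "\<And>k p. ro k p = FR k p (ro (Suc k) (par k p))" "\<And>k p. ro k p \<in> roles"
    "\<And>Z k p. (\<And>k p. Z k p \<Longrightarrow> FR k p Cross = Cross \<and> Z (Suc k) (par k p)) \<Longrightarrow> Z k p \<Longrightarrow> ro k p = Cross"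
  proof (rule ex_solution_tower[OF finite_roles, of Cross FR par])
    show "Cross \<in> roles" by (simp add: roles_def)
    show "FR k p y \<in> roles" if "y \<in> roles" for k p y
      using that px(5) unfolding FR_def pos_def by (cases p) (simp add: role_of_in_roles del: role_of.simps)
  qed blast
  define info where "info k p = (pos k p, Xs k p, ro k p)" for k p
  define x where "x k i j = (pos k (i, j), info (Suc k) (par k (i, j)))" for k i j
  have info_of_x: "info_of (x k i j) = info k (i, j)" for k i j
    using L[of k i j] ro(1)[of k "(i, j)"] unfolding x_def info_def FR_def pos_def par_def
    by (simp del: role_of.simps)
  have info_in: "info k p \<in> infos" for k p
    using px(5) py(5) ro(2) by (cases p) (simp add: info_def infos_def pos_def)
  have x_in: "x k i j \<in> addrs" for k i j
    using px(5) py(5) info_in by (simp add: x_def addrs_def pos_def)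
  have hc: "hcompat (x k (i - 1) j) (x k i j)" for k i j
    using px[of k i] n_ge by (cases "rx k i = 0") (simp_all add: hcompat_def x_def pos_def par_def)
  have vc: "vcompat (x k i (j - 1)) (x k i j)" for k i j
    using py[of k j] n_ge by (cases "ry k j = 0") (simp_all add: vcompat_def x_def pos_def par_def)
  \<comment> \<open>Row 0 carries the parent's wire, row 1 the parent's address. To the right of
    column 0 row 1 still holds the address of the left block, because the \<open>Main\<close> cell
    sits in column 1.\<close>
  define FH where "FH k = (\<lambda>(i, j) w. if ry k j = 0 then w else if ry k j = 1
      then Some (x (Suc k) (if rx k i = 0 then px k i - 1 else px k i) (py k j)) else None)" for k
  define FV where "FV k = (\<lambda>(i, j) w. if rx k i = 0 then w else if rx k i = 1
      then Some (x (Suc k) (px k i) (if ry k j = 0 then py k j - 1 else py k j)) else None)" for k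
  obtain h where h: "\<And>k p. h k p = FH k p (h (Suc k) (par k p))" "\<And>k p. h k p \<in> wires"
    "\<And>Z k p. (\<And>k p. Z k p \<Longrightarrow> FH k p None = None \<and> Z (Suc k) (par k p)) \<Longrightarrow> Z k p \<Longrightarrow> h k p = None"
  proof (rule ex_solution_tower[OF finite_wires, of None FH par])
    show "None \<in> wires" by (simp add: wires_def)
    show "FH k p y \<in> wires" if "y \<in> wires" for k p y
      using that by (cases p) (simp add: FH_def wires_def x_in)
  qed blast
  obtain v where v: "\<And>k p. v k p = FV k p (v (Suc k) (par k p))" "\<And>k p. v k p \<in> wires"
    "\<And>Z k p. (\<And>k p. Z k p \<Longrightarrow> FV k p None = None \<and> Z (Suc k) (par k p)) \<Longrightarrow> Z k p \<Longrightarrow> v k p = None"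
  proof (rule ex_solution_tower[OF finite_wires, of None FV par])
    show "None \<in> wires" by (simp add: wires_def)
    show "FV k p y \<in> wires" if "y \<in> wires" for k p y
      using that by (cases p) (simp add: FV_def wires_def x_in)
  qed blast
  have h': "h k (i, j) = (if ry k j = 0 then h (Suc k) (px k i, py k j) else if ry k j = 1
      then Some (x (Suc k) (if rx k i = 0 then px k i - 1 else px k i) (py k j)) else None)" for k i j
    using h(1)[of k "(i, j)"] by (simp add: FH_def par_def)
  have v': "v k (i, j) = (if rx k i = 0 then v (Suc k) (px k i, py k j) else if rx k i = 1
      then Some (x (Suc k) (px k i) (if ry k j = 0 then py k j - 1 else py k j)) else None)" for k i j
    using v(1)[of k "(i, j)"] by (simp add: FV_def par_def)
  have ro': "ro k (i, j) = role_of (rx k i, ry k j) (info (Suc k) (px k i, py k j))" for k i j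
    using ro(1)[of k "(i, j)"] by (simp add: FR_def info_def pos_def par_def)
  define ok where "ok k i j \<longleftrightarrow> local_rule (ro k (i, j)) (h k (i - 1, j)) (h k (i, j)) (v k (i, j)) (v k (i, j - 1))"
    for k i j
  \<comment> \<open>A defect propagates to all ancestors along corner cells, where all values are the defaults.\<close>
  have bad: "rx k i = 0 \<and> ry k j = 0 \<and> \<not> ok (Suc k) (px k i) (py k j)" if "\<not> ok k i j" for k i j
  proof -
    note facts = that[unfolded ok_def] px[of k i] py[of k j] n_ge
    note defs = h'[of k i j] h'[of k "i - 1" j] v'[of k i j] v'[of k i "j - 1"] ro'[of k i j]
    show ?thesis
    proof (cases "rx k i = 0")
      case rx: True
      show ?thesis
      proof (cases "ry k j = 0")
        case ry: True
        then show ?thesis using facts defs rx by (simp add: ok_def info_def)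
      next
        case ry: False
        then show ?thesis using facts defs rx by (simp split: if_splits)
      qed
    next
      case rx: False
      \<comment> \<open>Away from column 0, only the \<open>Main\<close> cell changes the content of
        a wire.\<close>
      have hh: "h k (i - 1, j) = h k (i, j)" if "\<not> (rx k i = 1 \<and> ry k j = 1)"
        using that facts(2-) defs rx by auto
      have vv: "v k (i, j - 1) = v k (i, j)" if "\<not> (rx k i = 1 \<and> ry k j = 1)"
        using that facts(2-) defs rx by auto
      consider "rx k i = 1 \<and> ry k j = 1" | "2 \<le> rx k i \<and> ry k j = 1" | "ry k j \<noteq> 1"
        using rx by linarith
      then have False
      proof cases
        case 1
        then show ?thesis
          using facts defs hc[of "Suc k" "px k i" "py k j"] vc[of "Suc k" "px k i" "py k j"]
          by simp
      next
        case 2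
        then show ?thesis
          using facts defs hh vv by (simp add: info_of_x)
      next
        case 3
        then show ?thesis
          using facts(1) defs(5) hh vv rx by simp
      qed
      then show ?thesis ..
    qed
  qed
  have ok: "ok k i j" for k i j
  proof (rule ccontr)
    assume neg: "\<not> ok k i j"
    \<comment> \<open>The defective cells are closed under parents and all lie in corners, where a
      cell copies its parent; hence role and wires are defaults, and \<open>Cross\<close> with four
      \<open>None\<close> wires is no defect.\<close>
    have "ro k (i, j) = Cross"
      by (rule ro(3)[where Z = "\<lambda>k (i, j). \<not> ok k i j"])
        (use neg bad in \<open>auto simp: FR_def pos_def par_def\<close>)
    moreover have "h k (i, j) = None"
      by (rule h(3)[where Z = "\<lambda>k (i, j). \<not> ok k i j"])
        (use neg bad in \<open>auto simp: FH_def par_def\<close>)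
    moreover have "v k (i, j) = None"
      by (rule v(3)[where Z = "\<lambda>k (i, j). \<not> ok k i j"])
        (use neg bad in \<open>auto simp: FV_def par_def\<close>)
    moreover have "h k (i - 1, j) = None"
    \<comment> \<open>For the incoming wire, \<open>Z\<close> follows left neighbours of defective
      cells. As the defective cell is in column 0, the parent of its left neighbour is the left
      neighbour of its parent.\<close>
    proof (rule h(3)[where Z = "\<lambda>k (i, j). \<not> ok k (i + 1) j"], goal_cases)
      case (1 k p)
      obtain i j where p: "p = (i, j)" by (cases p)
      show ?case using 1 bad[of k "i + 1" j] px(1)[of k "i + 1"] by (simp add: p FH_def par_def)
    qed (use neg in simp)
    moreover have "v k (i, j - 1) = None"
    proof (rule v(3)[where Z = "\<lambda>k (i, j). \<not> ok k i (j + 1)"], goal_cases)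
      case (1 k p)
      obtain i j where p: "p = (i, j)" by (cases p)
      show ?case using 1 bad[of k i "j + 1"] py(1)[of k "j + 1"] by (simp add: p FV_def par_def)
    qed (use neg in simp)
    ultimately show False using neg by (simp add: ok_def)
  qed
  have "valid (x 0) (\<lambda>i j. h 0 (i, j)) (\<lambda>i j. v 0 (i, j))"
    unfolding valid_def using x_in h(2) v(2) hc vc ok[of 0]
    by (simp add: ok_def role_def info_of_x info_def)
  moreover have "letter (x 0 i j) = X (i, j)" for i j
    by (simp add: letter_def info_of_x info_def Xs(1))
  ultimately show ?thesis by (rule that)
qed

subsection \<open>Encoding colours as numbers\<close>

text \<open>The right and top colours contain the address of the tile itself, the left and bottom
colours those of the neighbours.\<close>

definition tiles :: "(('a addr \<times> 'a addr option) \<Rightarrow> nat) \<Rightarrow> tile set" where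
  "tiles f = {(f (y, wl), f (x, wr), f (x, wt), f (z, wb)) | x y z wl wr wt wb.
     x \<in> addrs \<and> y \<in> addrs \<and> z \<in> addrs \<and> wl \<in> wires \<and> wr \<in> wires \<and> wt \<in> wires \<and> wb \<in> wires \<and>
     hcompat y x \<and> vcompat z x \<and> local_rule (role x) wl wr wt wb}"

lemma ex_tile_set:
  "\<exists>(\<tau> :: tile set) (e :: tile \<Rightarrow> 'a). finite \<tau> \<and>
     (\<forall>U. is_tiling \<tau> U \<longrightarrow> compatible n S (e \<circ> U)) \<and>
     (\<forall>X. compatible n S X \<longrightarrow> (\<exists>U. is_tiling \<tau> U \<and> trans_eq X (e \<circ> U)))"
proof -
  let ?C = "addrs \<times> wires"
  obtain f :: "'a addr \<times> 'a addr option \<Rightarrow> nat" where f: "inj_on f ?C"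
    using finite_imp_inj_to_nat_seg[of ?C] finite_addrs finite_wires by auto
  define g where "g = inv_into ?C f"
  have g: "g (f (x, w)) = (x, w)" if "x \<in> addrs" "w \<in> wires" for x w
    unfolding g_def using f that by (intro inv_into_f_f) auto
  define e where "e t = letter (fst (g (tile_right t)))" for t
  have "tiles f \<subseteq> f ` ?C \<times> f ` ?C \<times> f ` ?C \<times> f ` ?C"
    unfolding tiles_def by auto
  then have "finite (tiles f)"
    using finite_addrs finite_wires by (meson finite_SigmaI finite_imageI finite_subset)
  moreover have "compatible n S (e \<circ> U)" if U: "is_tiling (tiles f) U" for U
  proof -
    define x where "x i j = fst (g (tile_right (U (i, j))))" for i j
    define h where "h i j = snd (g (tile_right (U (i, j))))" for i j
    define v where "v i j = snd (g (tile_top (U (i, j))))" for i j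
    have "x i j \<in> addrs \<and> h i j \<in> wires \<and> v i j \<in> wires \<and>
     hcompat (x (i - 1) j) (x i j) \<and> vcompat (x i (j - 1)) (x i j) \<and>
     local_rule (role (x i j)) (h (i - 1) j) (h i j) (v i j) (v i (j - 1))" for i j
    proof -
      have all: "U (i, j) \<in> tiles f" for i j using U by (simp add: is_tiling_def)
      have r: "tile_right (U (i - 1, j)) = tile_left (U (i, j))"
        using U unfolding is_tiling_def by (metis diff_add_cancel)
      have t: "tile_top (U (i, j - 1)) = tile_bottom (U (i, j))"
        using U unfolding is_tiling_def by (metis diff_add_cancel)
      \<comment> \<open>A tile puts the same address into its top and right colours, so the address
        seen from above is the one that \<open>x\<close> reads off the right.\<close>
      have b: "fst (g (tile_top (U (i, j - 1)))) = x i (j - 1)"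
        using all[of i "j - 1"] unfolding tiles_def x_def
        by (auto simp: tile_top_def tile_right_def g)
      show ?thesis
        using all[of i j] b unfolding x_def h_def v_def r t unfolding tiles_def
        by (auto simp: tile_top_def tile_right_def tile_left_def tile_bottom_def g)
    qed
    then have "valid x h v" unfolding valid_def by blast
    moreover have "e \<circ> U = (\<lambda>(i, j). letter (x i j))" by (auto simp: e_def x_def)
    ultimately show ?thesis using valid_imp_compatible by metis
  qed
  moreover have "\<exists>U. is_tiling (tiles f) U \<and> trans_eq X (e \<circ> U)" if comp: "compatible n S X" for X
  proof -
    obtain x h v where V: "valid x h v" and X: "\<And>i j. letter (x i j) = X (i, j)"
      using compatible_imp_valid[OF comp] by blast
    define U where "U = (\<lambda>(i, j). (f (x (i - 1) j, h (i - 1) j), f (x i j, h i j), f (x i j, v i j),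
      f (x i (j - 1), v i (j - 1))))"
    have "U (i, j) \<in> tiles f" for i j
      unfolding U_def tiles_def mem_Collect_eq prod.case by (intro exI conjI, rule refl) (rule validD[OF V])+
    then have "is_tiling (tiles f) U"
      unfolding is_tiling_def
      by (auto simp: U_def tile_top_def tile_right_def tile_left_def tile_bottom_def)
    moreover have "X = e \<circ> U"
      using validD(1,2)[OF V] by (auto simp: e_def U_def tile_right_def g X)
    ultimately show ?thesis using trans_eq_refl by blast
  qed
  ultimately show ?thesis by blast
qed

end

section \<open>A sufficiently large power of the substitution\<close>

text \<open>With \<open>n = m ^ K\<close> and \<open>c\<close> letters, the left side bounds the
  number of infos (positions, letters, roles), and the right side counts the sets of
  \<open>n - 2\<close> bits.\<close>

lemma ex_large_power:
  fixes m c :: nat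
  assumes "m > 1"
  shows "\<exists>K>0. m ^ K \<ge> 3 \<and> m ^ K * m ^ K * (c * (2 + (m ^ K - 2) * 2)) \<le> 2 ^ (m ^ K - 2)"
proof -
  have "eventually (\<lambda>n::nat. real n ^ 4 \<le> 2 ^ n / 4) at_top" by real_asymp
  then obtain n0 where n0: "\<And>n. n \<ge> n0 \<Longrightarrow> real n ^ 4 \<le> 2 ^ n / 4"
    unfolding eventually_at_top_linorder by blast
  \<comment> \<open>Since \<open>n > K\<close>, this makes \<open>n\<close> exceed \<open>n0\<close>
    for the asymptotic bound, \<open>2 * c\<close> to absorb the number of letters, and 3.\<close>
  define K where "K = n0 + 2 * c + 3"
  define n where "n = m ^ K"
  have "K < 2 ^ K" by (rule less_exp)
  also have "2 ^ K \<le> n" using assms unfolding n_def by (intro power_mono) auto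
  finally have nK: "K < n" .
  have "real n ^ 4 \<le> 2 ^ n / 4" using nK by (intro n0) (simp add: K_def)
  also have "\<dots> = 2 ^ (n - 2)" using nK by (simp add: K_def power_diff)
  finally have "real (n ^ 4) \<le> real (2 ^ (n - 2))" by simp
  then have "n ^ 4 \<le> 2 ^ (n - 2)" by (simp only: of_nat_le_iff)
  moreover have "n * n * (c * (2 + (n - 2) * 2)) \<le> n * n * (n * n)"
  proof -
    have "c * (2 + (n - 2) * 2) \<le> c * (2 * n)" using nK by (intro mult_left_mono) (auto simp: K_def)
    also have "\<dots> = (2 * c) * n" by simp
    also have "\<dots> \<le> n * n" using nK by (intro mult_right_mono) (auto simp: K_def)
    finally show ?thesis by (intro mult_left_mono) auto
  qed
  moreover have "n ^ 4 = n * n * (n * n)" by (simp add: power_numeral_reduce)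
  moreover have "K > 0" "n \<ge> 3" using nK by (auto simp: K_def)
  ultimately have "K > 0 \<and> n \<ge> 3 \<and> n * n * (c * (2 + (n - 2) * 2)) \<le> 2 ^ (n - 2)"
    by linarith
  then show ?thesis unfolding n_def by blast
qed

theorem mainTheorem3:
  fixes s :: "'a::finite \<Rightarrow> nat \<Rightarrow> nat \<Rightarrow> 'a" and m :: nat
  assumes "m > 1"
  shows "\<exists>(\<tau> :: tile set) (e :: tile \<Rightarrow> 'a). finite \<tau> \<and>
           (\<forall>U. is_tiling \<tau> U \<longrightarrow> compatible m s (e \<circ> U)) \<and>
           (\<forall>X. compatible m s X \<longrightarrow> (\<exists>U. is_tiling \<tau> U \<and> trans_eq X (e \<circ> U)))"
proof -
  obtain K where K: "K > 0" "m ^ K \<ge> 3"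
    "m ^ K * m ^ K * (card (UNIV :: 'a set) * (2 + (m ^ K - 2) * 2)) \<le> 2 ^ (m ^ K - 2)"
    using ex_large_power[OF assms] by blast
  define n where "n = m ^ K"
  define N where "N = n - 2"
  define roles where "roles = insert Cross (insert Main (case_prod Check ` ({..<N} \<times> UNIV)))"
  define infos :: "'a info set" where "infos = ({..<n} \<times> {..<n}) \<times> UNIV \<times> roles"
  have "card (case_prod Check ` ({..<N} \<times> UNIV)) \<le> N * 2"
    using card_image_le[of "{..<N} \<times> (UNIV :: bool set)" "case_prod Check"] by simp
  then have "card roles \<le> 2 + N * 2"
    unfolding roles_def by (intro card_insert_le_m1) auto
  then have "n * n * (card (UNIV :: 'a set) * card roles) \<le> n * n * (card (UNIV :: 'a set) * (2 + N * 2))"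
    by (intro mult_le_mono le_refl)
  then have "card infos \<le> n * n * (card (UNIV :: 'a set) * (2 + N * 2))"
    by (simp add: infos_def card_cartesian_product mult.assoc)
  also have "\<dots> \<le> card (Pow {..<N})"
    using K(3) by (simp add: card_Pow n_def N_def)
  finally have "card infos \<le> card (Pow {..<N})" .
  moreover have "finite infos" by (simp add: infos_def roles_def)
  \<comment> \<open>Any injection into the bit sets will do as an encoding.\<close>
  ultimately obtain \<beta> where \<beta>: "\<beta> ` infos \<subseteq> Pow {..<N}" "inj_on \<beta> infos"
    using card_le_inj[of infos "Pow {..<N}"] by auto
  interpret self_similar n N "subst_pow m s K" \<beta> roles infos
  proof (unfold_locales, fold roles_def, fold infos_def)
    show "n = N + 2" "N > 0" using K(2) by (simp_all add: n_def N_def)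
    show "inj_on \<beta> infos" by (rule \<beta>(2))
    show "\<beta> I \<subseteq> {..<N}" if "I \<in> infos" for I using \<beta>(1) that by auto
  qed (simp_all add: roles_def infos_def)
  show ?thesis
    using ex_tile_set unfolding n_def using compatible_subst_pow_iff[of m K s] assms K(1) by simp
qed

end
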